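(* Let $\widehat Q\in\mathcal Q$ be any solution of the expected risk minimization problem $\min_{Q\in\mathcal Q}\mathcal R_{\exp}(Q)$, where $$\mathcal R_{\exp}(Q)=\mathbb E_{(s,a)\sim d^*}\bigl[-\log \hat p_Q(a\mid s)+\mathbf 1_{a=a_s}\,(\mathcal TQ(s,a)-Q(s,a))^2\bigr].$$ Then $\widehat Q(s,a)=Q^*(s,a)$ for all $s\in\bar{\mathcal S}$ and $a\in\mathcal A$. Furthermore, $r$ is uniquely identified on $\bar{\mathcal S}\times\mathcal A$ by $$r(s,a)=\widehat Q(s,a)-\beta\,\mathbb E_{s'\sim P(s,a)}\bigl[V_{\widehat Q}(s')\bigr],\qquad s\in\bar{\mathcal S},\ a\in\mathcal A.$$
   Context: Setting. $(\mathcal S,\mathcal A,P,\nu_0,r,\beta)$ is a Markov decision process with state space $\mathcal S$, finite action space $\mathcal A$, transition kernel $P(\cdot\mid s,a)$ (also written $P(s,a)$), initial state distribution $\nu_0$, deterministic reward $r:\mathcal S\times\mathcal A\to\mathbb R$, discount factor $\beta\in(0,1)$. Let $\mathcal Q=\{Q:\mathcal S\times\mathcal A\to\mathbb R:\|Q\|_\infty<\infty\}$. For $Q\in\mathcal Q$ put $V_Q(s)=\log\sum_{a\in\mathcal A}\exp Q(s,a)$, $\hat p_Q(a\mid s)=\exp(Q(s,a))/\sum_{b\in\mathcal A}\exp(Q(s,b))$, and $\mathcal TQ(s,a)=r(s,a)+\beta\,\mathbb E_{s'\sim P(s,a)}[V_Q(s')]$. $Q^*\in\mathcal Q$ is the unique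 solution of $\mathcal TQ^*=Q^*$. The expert (entropy-regularized optimal) policy, i.e. the maximizer of $\mathbb E_\pi[\sum_{h\ge 0}\beta^h(r(s_h,a_h)+\mathcal H(\pi(\cdot\mid s_h)))]$ with $\mathcal H$ the Shannon entropy, is $\pi^*(a\mid s)=\hat p_{Q^*}(a\mid s)$; the data-generating agent follows $\pi^*$. $d^*$ denotes the state-action distribution generated by $\nu_0$ and $\pi^*$, namely the discounted occupancy $d^*=(1-\beta)\sum_{t\ge0}\beta^t\,\mathbb P_{\nu_0,\pi^*}\{(s_t,a_t)\in\cdot\}$. $\bar{\mathcal S}=\{s\in\mathcal S:\mathbb P_{\nu_0,\pi^*}(s_h=s)>0\text{ for some }h\ge 0\}$ is the set of reachable states. Anchor actions: for each $s\in\mathcal S$ there is a given action $a_s\in\mathcal A$ for which $r(s,a_s)$ is known. *)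

theory Defs
  imports "HOL-Probability.Probability"
begin

text \<open>
  The state space is a measurable space \<open>M\<close> (with \<open>M = count_space S\<close> for a countable \<open>S\<close> every
  measurability condition below is void); the action space is the finite type \<open>'a\<close>.
  The kernel \<open>P s a\<close> is a probability measure on \<open>M\<close>.
\<close>

definition mdp ::
  "'s measure \<Rightarrow> ('s \<Rightarrow> 'a::finite \<Rightarrow> 's measure) \<Rightarrow> 's measure \<Rightarrow> ('s \<Rightarrow> 'a \<Rightarrow> real) \<Rightarrow> real \<Rightarrow> bool" where
  "mdp M P \<nu> r \<beta> \<longleftrightarrow>
     (\<forall>a. (\<lambda>s. P s a) \<in> M \<rightarrow>\<^sub>M prob_algebra M) \<and>
     \<nu> \<in> space (prob_algebra M) \<and>
     (\<forall>a. (\<lambda>s. r s a) \<in> borel_measurable M) \<and>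
     0 < \<beta> \<and> \<beta> < 1"

text \<open>Boundedness is in the supremum norm, not up to null sets.\<close>

definition bounded_Q :: "'s measure \<Rightarrow> ('s \<Rightarrow> 'a::finite \<Rightarrow> real) set" where
  "bounded_Q M = {Q. (\<forall>a. (\<lambda>s. Q s a) \<in> borel_measurable M) \<and>
                     (\<exists>B. \<forall>s\<in>space M. \<forall>a. \<bar>Q s a\<bar> \<le> B)}"

definition soft_value :: "('s \<Rightarrow> 'a::finite \<Rightarrow> real) \<Rightarrow> 's \<Rightarrow> real" where
  "soft_value Q s = ln (\<Sum>a\<in>UNIV. exp (Q s a))"

definition choice_prob :: "('s \<Rightarrow> 'a::finite \<Rightarrow> real) \<Rightarrow> 's \<Rightarrow> 'a \<Rightarrow> real" where
  "choice_prob Q s a = exp (Q s a) / (\<Sum>b\<in>UNIV. exp (Q s b))"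

definition soft_bellman ::
  "('s \<Rightarrow> 'a::finite \<Rightarrow> 's measure) \<Rightarrow> ('s \<Rightarrow> 'a \<Rightarrow> real) \<Rightarrow> real \<Rightarrow> ('s \<Rightarrow> 'a \<Rightarrow> real) \<Rightarrow> 's \<Rightarrow> 'a \<Rightarrow> real" where
  "soft_bellman P r \<beta> Q s a = r s a + \<beta> * (\<integral>s'. soft_value Q s' \<partial>(P s a))"

text \<open>
  The soft Bellman operator is a \<open>\<beta>\<close>-contraction, so its fixed point in \<open>bounded_Q M\<close> is unique on
  \<open>space M\<close> (see \<open>soft_optimal_Q_unique\<close>).  Existence of such a fixed point forces \<open>r\<close> to be bounded.
\<close>

definition soft_optimal_Q ::
  "'s measure \<Rightarrow> ('s \<Rightarrow> 'a::finite \<Rightarrow> 's measure) \<Rightarrow> ('s \<Rightarrow> 'a \<Rightarrow> real) \<Rightarrow> real \<Rightarrow> ('s \<Rightarrow> 'a \<Rightarrow> real) \<Rightarrow> bool" where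
  "soft_optimal_Q M P r \<beta> Q \<longleftrightarrow>
     Q \<in> bounded_Q M \<and> (\<forall>s\<in>space M. \<forall>a. soft_bellman P r \<beta> Q s a = Q s a)"

definition softmax_policy :: "('s \<Rightarrow> 'a::finite \<Rightarrow> real) \<Rightarrow> 's \<Rightarrow> 'a pmf" where
  "softmax_policy Q s = embed_pmf (choice_prob Q s)"

text \<open>Law of the state \<open>s\<^sub>h\<close> when \<open>s\<^sub>0 \<sim> \<nu>\<close>, \<open>a\<^sub>t \<sim> \<pi> s\<^sub>t\<close> and \<open>s\<^sub>t\<^sub>+\<^sub>1 \<sim> P s\<^sub>t a\<^sub>t\<close>.\<close>

primrec state_law ::
  "('s \<Rightarrow> 'a::finite \<Rightarrow> 's measure) \<Rightarrow> 's measure \<Rightarrow> ('s \<Rightarrow> 'a pmf) \<Rightarrow> nat \<Rightarrow> 's measure" where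
  "state_law P \<nu> \<pi> 0 = \<nu>"
| "state_law P \<nu> \<pi> (Suc h) =
     state_law P \<nu> \<pi> h \<bind> (\<lambda>s. measure_pmf (\<pi> s) \<bind> (\<lambda>a. P s a))"

definition state_action_law ::
  "'s measure \<Rightarrow> ('s \<Rightarrow> 'a::finite \<Rightarrow> 's measure) \<Rightarrow> 's measure \<Rightarrow> ('s \<Rightarrow> 'a pmf) \<Rightarrow> nat \<Rightarrow> ('s \<times> 'a) measure" where
  "state_action_law M P \<nu> \<pi> h =
     state_law P \<nu> \<pi> h \<bind>
       (\<lambda>s. distr (measure_pmf (\<pi> s)) (M \<Otimes>\<^sub>M count_space UNIV) (\<lambda>a. (s, a)))"

definition occupancy ::
  "'s measure \<Rightarrow> ('s \<Rightarrow> 'a::finite \<Rightarrow> 's measure) \<Rightarrow> 's measure \<Rightarrow> real \<Rightarrow> ('s \<Rightarrow> 'a pmf) \<Rightarrow> ('s \<times> 'a) measure" where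
  "occupancy M P \<nu> \<beta> \<pi> =
     measure_of (space M \<times> UNIV) (sets (M \<Otimes>\<^sub>M count_space UNIV))
       (\<lambda>X. \<Sum>t. ennreal ((1 - \<beta>) * \<beta> ^ t) * emeasure (state_action_law M P \<nu> \<pi> t) X)"

definition reachable_states ::
  "'s measure \<Rightarrow> ('s \<Rightarrow> 'a::finite \<Rightarrow> 's measure) \<Rightarrow> 's measure \<Rightarrow> ('s \<Rightarrow> 'a pmf) \<Rightarrow> 's set" where
  "reachable_states M P \<nu> \<pi> = {s \<in> space M. \<exists>h. measure (state_law P \<nu> \<pi> h) {s} > 0}"

text \<open>
  \<open>anch s\<close> is the anchor action at \<open>s\<close> and \<open>d\<close> the data distribution.  The risk depends on \<open>r\<close> only
  through the values \<open>r s (anch s)\<close>.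
\<close>

definition exp_risk ::
  "('s \<Rightarrow> 'a::finite \<Rightarrow> 's measure) \<Rightarrow> ('s \<Rightarrow> 'a \<Rightarrow> real) \<Rightarrow> real \<Rightarrow> ('s \<Rightarrow> 'a) \<Rightarrow> ('s \<times> 'a) measure
    \<Rightarrow> ('s \<Rightarrow> 'a \<Rightarrow> real) \<Rightarrow> real" where
  "exp_risk P r \<beta> anch d Q =
     (\<integral>(s, a). - ln (choice_prob Q s a)
        + of_bool (a = anch s) * (soft_bellman P r \<beta> Q s a - Q s a)\<^sup>2 \<partial>d)"

lemma choice_prob_nonneg: "0 \<le> choice_prob Q s a"
  by (simp add: choice_prob_def sum_nonneg)

lemma sum_exp_pos: "0 < (\<Sum>b\<in>(UNIV::'a::finite set). exp (f b :: real))"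
  by (rule sum_pos) auto

lemma pmf_softmax_policy: "pmf (softmax_policy Q s) a = choice_prob Q s a"
  unfolding softmax_policy_def
proof (rule pmf_embed_pmf)
  have "(\<integral>\<^sup>+a. ennreal (choice_prob Q s a) \<partial>count_space UNIV) = ennreal (\<Sum>a\<in>UNIV. choice_prob Q s a)"
    by (subst nn_integral_count_space_finite) (auto simp: sum_ennreal choice_prob_nonneg)
  also have "(\<Sum>a\<in>UNIV. choice_prob Q s a) = 1"
    using sum_exp_pos[of "Q s"]
    by (simp add: choice_prob_def flip: sum_divide_distrib)
  finally show "(\<integral>\<^sup>+a. ennreal (choice_prob Q s a) \<partial>count_space UNIV) = 1" by simp
qed (rule choice_prob_nonneg)

lemma soft_value_diff_le:
  assumes "\<And>a. Q s a \<le> Q' s a + c"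
  shows "soft_value Q s \<le> soft_value Q' s + c"
proof -
  have "(\<Sum>a\<in>UNIV. exp (Q s a)) \<le> (\<Sum>a\<in>UNIV. exp (Q' s a)) * exp c"
    using assms by (auto simp: sum_distrib_right simp flip: exp_add intro!: sum_mono)
  then have "soft_value Q s \<le> ln ((\<Sum>a\<in>UNIV. exp (Q' s a)) * exp c)"
    unfolding soft_value_def using sum_exp_pos[of "Q s"] by (intro ln_mono) auto
  also have "\<dots> = soft_value Q' s + c"
    unfolding soft_value_def using sum_exp_pos[of "Q' s"] by (simp add: ln_mult)
  finally show ?thesis .
qed

lemma soft_value_diff_abs_le:
  assumes "\<And>a. \<bar>Q s a - Q' s a\<bar> \<le> c"
  shows "\<bar>soft_value Q s - soft_value Q' s\<bar> \<le> c"
proof -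
  have "Q s a \<le> Q' s a + c" "Q' s a \<le> Q s a + c" for a
    using assms[of a] by auto
  from soft_value_diff_le[of Q s Q' c, OF this(1)] soft_value_diff_le[of Q' s Q c, OF this(2)]
  show ?thesis by auto
qed

lemma soft_value_measurable:
  assumes "Q \<in> bounded_Q M"
  shows "soft_value Q \<in> borel_measurable M"
proof -
  have [measurable]: "\<And>a. (\<lambda>s. Q s a) \<in> borel_measurable M"
    using assms by (auto simp: bounded_Q_def)
  show ?thesis unfolding soft_value_def[abs_def] by measurable
qed

lemma soft_value_integrable:
  fixes Q :: "'s \<Rightarrow> 'a::finite \<Rightarrow> real"
  assumes Q: "Q \<in> bounded_Q M" and N: "N \<in> space (prob_algebra M)"
  shows "integrable N (soft_value Q)"
proof -
  have sets: "sets N = sets M" and "prob_space N"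
    using N by (auto simp: space_prob_algebra)
  then interpret prob_space N by simp
  obtain B where B: "\<And>s a. s \<in> space M \<Longrightarrow> \<bar>Q s a\<bar> \<le> B"
    using Q by (auto simp: bounded_Q_def)
  have diff: "\<bar>soft_value Q s - soft_value (\<lambda>_ (_::'a). 0) s\<bar> \<le> B" if "s \<in> space M" for s
    by (rule soft_value_diff_abs_le) (use B[OF that] in simp)
  then have "\<bar>soft_value Q s\<bar> \<le> B + \<bar>ln (of_nat CARD('a))\<bar>" if "s \<in> space M" for s
    using diff[OF that] abs_triangle_ineq2[of "soft_value Q s" "ln (of_nat CARD('a))"]
    by (simp add: soft_value_def)
  then show ?thesis
    using soft_value_measurable[OF Q] sets sets_eq_imp_space_eq[OF sets]
    by (intro integrable_const_bound[of _ "B + \<bar>ln (of_nat CARD('a))\<bar>"])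
       (auto simp: measurable_cong_sets[OF sets refl])
qed

lemma soft_optimal_Q_unique:
  assumes mdp: "mdp M P \<nu> r \<beta>"
    and Q: "soft_optimal_Q M P r \<beta> Q" and Q': "soft_optimal_Q M P r \<beta> Q'"
    and s: "s \<in> space M"
  shows "Q s a = Q' s a"
proof -
  from Q Q' obtain B B' where
    B: "\<And>s a. s \<in> space M \<Longrightarrow> \<bar>Q s a\<bar> \<le> B" and B': "\<And>s a. s \<in> space M \<Longrightarrow> \<bar>Q' s a\<bar> \<le> B'"
    by (simp add: soft_optimal_Q_def bounded_Q_def) blast
  have \<beta>: "0 < \<beta>" "\<beta> < 1" using mdp by (auto simp: mdp_def)
  have bound: "\<forall>s\<in>space M. \<forall>a. \<bar>Q s a - Q' s a\<bar> \<le> \<beta> ^ n * (B + B')" for n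
  proof (induction n)
    case 0
    show ?case using B B' by (fastforce intro: order.trans[OF abs_triangle_ineq4] add_mono)
  next
    case (Suc n)
    show ?case
    proof (intro ballI allI)
      fix s a assume s: "s \<in> space M"
      have P: "P s a \<in> space (prob_algebra M)"
        using mdp s by (auto simp: mdp_def measurable_def)
      then interpret prob_space "P s a" by (simp add: space_prob_algebra)
      have sp: "space (P s a) = space M"
        using P by (intro sets_eq_imp_space_eq) (simp add: space_prob_algebra)
      have i: "integrable (P s a) (soft_value Q)" "integrable (P s a) (soft_value Q')"
        using Q Q' P by (auto simp: soft_optimal_Q_def intro: soft_value_integrable)
      have "\<bar>Q s a - Q' s a\<bar> =
          \<beta> * \<bar>(\<integral>s'. soft_value Q s' - soft_value Q' s' \<partial>(P s a))\<bar>"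
      proof -
        have "Q s a = soft_bellman P r \<beta> Q s a" "Q' s a = soft_bellman P r \<beta> Q' s a"
          using Q Q' s by (auto simp: soft_optimal_Q_def)
        then have "Q s a - Q' s a = \<beta> * (\<integral>s'. soft_value Q s' - soft_value Q' s' \<partial>(P s a))"
          using i by (simp add: soft_bellman_def right_diff_distrib)
        then show ?thesis using \<beta> by (simp add: abs_mult)
      qed
      also have "\<dots> \<le> \<beta> * (\<integral>s'. \<bar>soft_value Q s' - soft_value Q' s'\<bar> \<partial>(P s a))"
        using \<beta> by (intro mult_left_mono integral_abs_bound) auto
      also have "\<dots> \<le> \<beta> * (\<beta> ^ n * (B + B'))"
      proof (intro mult_left_mono integral_le_const)
        show "integrable (P s a) (\<lambda>s'. \<bar>soft_value Q s' - soft_value Q' s'\<bar>)"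
          using i by auto
        show "AE s' in P s a. \<bar>soft_value Q s' - soft_value Q' s'\<bar> \<le> \<beta> ^ n * (B + B')"
          using Suc.IH sp by (intro AE_I2 soft_value_diff_abs_le) auto
      qed (use \<beta> in auto)
      finally show "\<bar>Q s a - Q' s a\<bar> \<le> \<beta> ^ Suc n * (B + B')" by (simp add: mult.assoc)
    qed
  qed
  have "(\<lambda>n. \<beta> ^ n * (B + B')) \<longlonglongrightarrow> 0 * (B + B')"
    using \<beta> by (intro tendsto_mult_right LIMSEQ_realpow_zero) auto
  then have "\<bar>Q s a - Q' s a\<bar> \<le> 0 * (B + B')"
    using bound s by (intro LIMSEQ_le_const) blast+
  then show ?thesis by simp
qed

lemma softmax_policy_measurable:
  assumes "Q \<in> bounded_Q M"
  shows "(\<lambda>s. measure_pmf (softmax_policy Q s)) \<in> M \<rightarrow>\<^sub>M prob_algebra (count_space UNIV)"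
proof (rule measurable_prob_algebraI)
  show "(\<lambda>s. measure_pmf (softmax_policy Q s)) \<in> M \<rightarrow>\<^sub>M subprob_algebra (count_space UNIV)"
  proof (rule measurable_subprob_algebra)
    fix X :: "'b set"
    have eq: "emeasure (measure_pmf (softmax_policy Q s)) X = (\<Sum>a\<in>X. ennreal (choice_prob Q s a))" for s
      by (simp add: emeasure_measure_pmf_finite pmf_softmax_policy choice_prob_nonneg)
    have [measurable]: "\<And>a. (\<lambda>s. Q s a) \<in> borel_measurable M"
      using assms by (auto simp: bounded_Q_def)
    show "(\<lambda>s. emeasure (measure_pmf (softmax_policy Q s)) X) \<in> borel_measurable M"
      unfolding eq choice_prob_def by measurable
  qed (auto intro: prob_space_imp_subprob_space prob_space_measure_pmf)
qed (rule prob_space_measure_pmf)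

lemma kernel_pair_measurable:
  fixes P :: "'s \<Rightarrow> 'a::finite \<Rightarrow> 's measure"
  assumes "mdp M P \<nu> r \<beta>"
  shows "(\<lambda>(s, a). P s a) \<in> M \<Otimes>\<^sub>M count_space UNIV \<rightarrow>\<^sub>M prob_algebra M"
proof -
  have "(\<lambda>x. P (fst x) (snd x)) \<in> M \<Otimes>\<^sub>M count_space UNIV \<rightarrow>\<^sub>M prob_algebra M"
  proof (rule measurable_compose_countable'[where f = "\<lambda>a x. P (fst x) a" and g = snd and I = UNIV])
    show "(\<lambda>x. P (fst x) a) \<in> M \<Otimes>\<^sub>M count_space UNIV \<rightarrow>\<^sub>M prob_algebra M" for a
      using assms by (auto simp: mdp_def intro: measurable_compose[OF measurable_fst])
  qed auto
  then show ?thesis by (simp add: split_beta')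
qed

lemma bind_in_prob_algebra:
  assumes "N \<in> space (prob_algebra M)" "f \<in> M \<rightarrow>\<^sub>M prob_algebra R"
  shows "N \<bind> f \<in> space (prob_algebra R)"
proof -
  have "(\<lambda>_. N) \<in> count_space {()} \<rightarrow>\<^sub>M prob_algebra M"
    using assms(1) by simp
  from measurable_space[OF measurable_bind_prob_space[OF this assms(2)], of "()"]
  show ?thesis by simp
qed

lemma state_law_in_prob_algebra:
  assumes "mdp M P \<nu> r \<beta>" "Q \<in> bounded_Q M"
  shows "state_law P \<nu> (softmax_policy Q) h \<in> space (prob_algebra M)"
proof (induction h)
  case 0
  then show ?case using assms(1) by (simp add: mdp_def)
next
  case (Suc h)
  have "(\<lambda>s. measure_pmf (softmax_policy Q s) \<bind> (\<lambda>a. P s a)) \<in> M \<rightarrow>\<^sub>M prob_algebra M"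
    using kernel_pair_measurable[OF assms(1)]
    by (intro measurable_bind_prob_space2[OF softmax_policy_measurable[OF assms(2)]])
  then show ?case
    using bind_in_prob_algebra[OF Suc] by simp
qed

lemma state_action_law_in_prob_algebra:
  assumes "mdp M P \<nu> r \<beta>" "Q \<in> bounded_Q M"
  shows "state_action_law M P \<nu> (softmax_policy Q) h \<in> space (prob_algebra (M \<Otimes>\<^sub>M count_space UNIV))"
proof -
  have "(\<lambda>s. distr (measure_pmf (softmax_policy Q s)) (M \<Otimes>\<^sub>M count_space UNIV) (\<lambda>a. (s, a)))
      \<in> M \<rightarrow>\<^sub>M prob_algebra (M \<Otimes>\<^sub>M count_space UNIV)"
    by (intro measurable_distr_prob_space2[OF softmax_policy_measurable[OF assms(2)]]) simp
  then show ?thesis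
    unfolding state_action_law_def
    by (rule bind_in_prob_algebra[OF state_law_in_prob_algebra[OF assms]])
qed

lemma emeasure_occupancy:
  fixes P :: "'s \<Rightarrow> 'a::finite \<Rightarrow> 's measure"
  assumes "mdp M P \<nu> r \<beta>" "Q \<in> bounded_Q M" "X \<in> sets (M \<Otimes>\<^sub>M count_space UNIV)"
  shows "emeasure (occupancy M P \<nu> \<beta> (softmax_policy Q)) X =
    (\<Sum>t. ennreal ((1 - \<beta>) * \<beta> ^ t) * emeasure (state_action_law M P \<nu> (softmax_policy Q) t) X)"
    (is "_ = ?\<mu> X")
proof -
  let ?N = "M \<Otimes>\<^sub>M count_space (UNIV :: 'a set)"
  have s: "sets (state_action_law M P \<nu> (softmax_policy Q) t) = sets ?N" for t
    using state_action_law_in_prob_algebra[OF assms(1,2)] by (auto simp: space_prob_algebra)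
  show ?thesis
    unfolding occupancy_def
  proof (rule emeasure_measure_of_sigma)
    show "sigma_algebra (space M \<times> UNIV) (sets ?N)"
      by (metis sets.sigma_algebra_axioms space_pair_measure space_count_space)
    show "positive (sets ?N) ?\<mu>" by (simp add: positive_def)
    show "countably_additive (sets ?N) ?\<mu>"
    proof (rule countably_additiveI)
      fix A :: "nat \<Rightarrow> ('s \<times> 'a) set"
      assume A: "range A \<subseteq> sets ?N" "disjoint_family A"
      have "(\<Sum>i. ?\<mu> (A i)) = (\<Sum>t. \<Sum>i. ennreal ((1 - \<beta>) * \<beta> ^ t) *
          emeasure (state_action_law M P \<nu> (softmax_policy Q) t) (A i))"
        using nn_integral_suminf[of "\<lambda>i t. ennreal ((1 - \<beta>) * \<beta> ^ t) *
          emeasure (state_action_law M P \<nu> (softmax_policy Q) t) (A i)" "count_space UNIV"]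
        by (simp add: nn_integral_count_space_nat)
      also have "\<dots> = ?\<mu> (\<Union>(range A))"
        using A s by (simp add: ennreal_suminf_cmult suminf_emeasure)
      finally show "(\<Sum>i. ?\<mu> (A i)) = ?\<mu> (\<Union>(range A))" .
    qed
  qed (use assms in auto)
qed

end

theory Submission
  imports Defs
begin

text \<open>
  With \<open>x = choice_prob Q s a / choice_prob Qstar s a\<close> one has \<open>E x = 1\<close> under the occupancy measure,
  so the excess risk of \<open>Q\<close> over \<open>Qstar\<close> is the mean of the nonnegative function \<open>x - 1 - ln x\<close> plus
  the squared Bellman residual at the anchor.  Hence the minimizers are the \<open>Q\<close> for which almost surely
  the choice probabilities agree with those of \<open>Qstar\<close> and the anchor residual vanishes.  For such a
  \<open>Q\<close> the difference \<open>Q s a - Qstar s a\<close> equals the difference of soft values at \<open>s\<close> for every \<open>a\<close>, and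
  the Bellman equation at the anchor bounds it by \<open>\<beta>\<close> times its supremum over the successors, which
  are charged only to states visited one step later.  Iterating, it vanishes almost surely at every time,
  hence at every atom.  For the identification of \<open>r\<close>: the risk sees \<open>r\<close> only at the anchors, so a
  competing \<open>Qstar'\<close> with the same occupancy is itself a minimizer.
\<close>

section \<open>Functions on state-action pairs, atoms, and elementary facts on softmax\<close>

lemma measurable_pair_finite:
  fixes f :: "'s \<Rightarrow> 'a::finite \<Rightarrow> 'b"
  assumes "\<And>a. (\<lambda>s. f s a) \<in> M \<rightarrow>\<^sub>M R"
  shows "(\<lambda>(s, a). f s a) \<in> M \<Otimes>\<^sub>M count_space UNIV \<rightarrow>\<^sub>M R"
proof -
  have "(\<lambda>x. f (fst x) (snd x)) \<in> M \<Otimes>\<^sub>M count_space UNIV \<rightarrow>\<^sub>M R"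
  proof (rule measurable_compose_countable'[where f = "\<lambda>a x. f (fst x) a" and g = snd and I = UNIV])
    show "(\<lambda>x. f (fst x) a) \<in> M \<Otimes>\<^sub>M count_space UNIV \<rightarrow>\<^sub>M R" for a
      by (rule measurable_compose[OF measurable_fst assms])
  qed auto
  then show ?thesis by (simp add: split_beta')
qed

text \<open>A null set cannot contain a point of positive mass. This is what turns almost sure
  statements into pointwise ones at reachable states.\<close>

lemma AE_at_atom:
  assumes "AE x in N. Q x" "measure N {s} > 0"
  shows "Q s"
proof (rule ccontr)
  assume "\<not> Q s"
  from assms(1) obtain A where A: "{x \<in> space N. \<not> Q x} \<subseteq> A" "emeasure N A = 0" "A \<in> sets N"
    by (rule AE_E)
  \<comment> \<open>\<open>measure\<close> is 0 off the sigma-algebra, so positive mass already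
    makes the singleton measurable.\<close>
  have "{s} \<in> sets N" using assms(2) by (metis less_irrefl measure_notin_sets)
  then have "s \<in> A" using A(1) \<open>\<not> Q s\<close> sets.sets_into_space by blast
  then have "emeasure N {s} \<le> emeasure N A" using A(3) by (intro emeasure_mono) auto
  then have "emeasure N {s} = 0" using A(2) by simp
  then show False using assms(2) by (simp add: measure_def)
qed

lemma choice_prob_pos: "0 < choice_prob Q s a"
  unfolding choice_prob_def using sum_exp_pos[of "Q s"] by simp

lemma sum_choice_prob: "(\<Sum>a\<in>UNIV. choice_prob Q s a) = 1"
  using sum_exp_pos[of "Q s"] by (simp add: choice_prob_def flip: sum_divide_distrib)

text \<open>Choice probabilities determine \<open>Q\<close> up to a shift that depends on the state
  only; this identity names the shift.\<close>

lemma ln_choice_prob: "ln (choice_prob Q s a) = Q s a - soft_value Q s"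
  unfolding choice_prob_def soft_value_def using sum_exp_pos[of "Q s"] by (simp add: ln_div)

lemma soft_value_bounded:
  fixes Q :: "'s \<Rightarrow> 'b::finite \<Rightarrow> real"
  assumes "Q \<in> bounded_Q M"
  obtains B where "\<And>s. s \<in> space M \<Longrightarrow> \<bar>soft_value Q s\<bar> \<le> B"
proof -
  obtain B where B: "\<And>s a. s \<in> space M \<Longrightarrow> \<bar>Q s a\<bar> \<le> B"
    using assms by (auto simp: bounded_Q_def)
  have "\<bar>soft_value Q s\<bar> \<le> B + \<bar>soft_value (\<lambda>_ (_::'b). 0 :: real) s\<bar>" if "s \<in> space M" for s
    using soft_value_diff_abs_le[of Q s "\<lambda>_ (_::'b). 0" B] B[OF that] by auto
  then show ?thesis
    \<comment> \<open>The soft value of the zero function is the log of the number of actions at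
      every state, so \<open>undefined\<close> serves as an arbitrary state.\<close>
    by (intro that[of "B + \<bar>soft_value (\<lambda>_ (_::'b). 0 :: real) undefined\<bar>"]) (auto simp: soft_value_def)
qed

text \<open>The pointwise inequality behind the nonnegativity of Kullback-Leibler
  divergence.\<close>

lemma ratio_minus_ln_nonneg:
  fixes x :: real
  assumes "0 < x"
  shows "0 \<le> x - 1 - ln x"
  using ln_le_minus_one[OF assms] by simp

section \<open>State laws under the softmax policy of the optimal Q-function\<close>

locale soft_optimal_mdp =
  fixes M :: "'s measure"
    and P :: "'s \<Rightarrow> 'a::finite \<Rightarrow> 's measure"
    and \<nu> :: "'s measure"
    and r :: "'s \<Rightarrow> 'a \<Rightarrow> real"
    and \<beta> :: real
    and Qs :: "'s \<Rightarrow> 'a \<Rightarrow> real"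
  assumes mdp: "mdp M P \<nu> r \<beta>"
    and opt: "soft_optimal_Q M P r \<beta> Qs"
begin

abbreviation "MA \<equiv> M \<Otimes>\<^sub>M count_space (UNIV :: 'a set)"
abbreviation "law \<equiv> state_law P \<nu> (softmax_policy Qs)"
abbreviation "alaw \<equiv> state_action_law M P \<nu> (softmax_policy Qs)"
abbreviation "occ \<equiv> occupancy M P \<nu> \<beta> (softmax_policy Qs)"

lemma Qs_bounded: "Qs \<in> bounded_Q M"
  using opt by (simp add: soft_optimal_Q_def)

lemma beta: "0 < \<beta>" "\<beta> < 1"
  using mdp by (auto simp: mdp_def)

lemma kernel: "s \<in> space M \<Longrightarrow> P s a \<in> space (prob_algebra M)"
  using mdp by (auto simp: mdp_def measurable_def)

lemma space_kernel: "s \<in> space M \<Longrightarrow> space (P s a) = space M"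
  using kernel[of s a] by (intro sets_eq_imp_space_eq) (simp add: space_prob_algebra)

lemma sets_law: "sets (law t) = sets M"
  using state_law_in_prob_algebra[OF mdp Qs_bounded] by (simp add: space_prob_algebra)

lemma space_law: "space (law t) = space M"
  by (rule sets_eq_imp_space_eq[OF sets_law])

lemma prob_space_law: "prob_space (law t)"
  using state_law_in_prob_algebra[OF mdp Qs_bounded] by (simp add: space_prob_algebra)

lemma policy_kernel_measurable:
  "(\<lambda>s. measure_pmf (softmax_policy Qs s) \<bind> (\<lambda>a. P s a)) \<in> M \<rightarrow>\<^sub>M subprob_algebra M"
  using kernel_pair_measurable[OF mdp]
  by (intro measurable_prob_algebraD
      measurable_bind_prob_space2[OF softmax_policy_measurable[OF Qs_bounded]])

lemma pair_kernel_measurable: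
  "(\<lambda>s. distr (measure_pmf (softmax_policy Qs s)) MA (\<lambda>a. (s, a))) \<in> M \<rightarrow>\<^sub>M subprob_algebra MA"
  by (intro measurable_prob_algebraD
      measurable_distr_prob_space2[OF softmax_policy_measurable[OF Qs_bounded]]) simp

text \<open>Exponentials are positive, so no action is ever excluded; hence almost sure statements
  about the sampled action hold for all actions.\<close>

lemma set_softmax_policy: "set_pmf (softmax_policy Q s) = UNIV"
  by (auto simp: set_pmf_eq pmf_softmax_policy less_imp_neq[OF choice_prob_pos, symmetric])

text \<open>Almost sure properties pass through \<open>bind\<close> as iterated ones, and the
  quantifier over the action becomes universal by full support. Read from left to right, it
  transfers knowledge at one time to the successors of states at the previous time.\<close>

lemma AE_law_Suc:
  assumes [measurable]: "Measurable.pred M G"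
  shows "(AE s in law (Suc t). G s) \<longleftrightarrow> (AE s in law t. \<forall>a. AE s' in P s a. G s')"
proof -
  have "(AE s in law (Suc t). G s) \<longleftrightarrow>
      (AE s in law t. AE s' in measure_pmf (softmax_policy Qs s) \<bind> (\<lambda>a. P s a). G s')"
    unfolding state_law.simps
    by (rule AE_bind[where B = M])
       (use policy_kernel_measurable in \<open>auto simp: measurable_cong_sets[OF sets_law refl]\<close>)
  also have "\<dots> \<longleftrightarrow> (AE s in law t. \<forall>a. AE s' in P s a. G s')"
  proof (rule AE_cong)
    fix s assume "s \<in> space (law t)"
    then have s: "s \<in> space M" by (simp add: space_law)
    have "(\<lambda>a. P s a) \<in> measure_pmf (softmax_policy Qs s) \<rightarrow>\<^sub>M subprob_algebra M"
      using kernel[OF s]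
      by (auto simp: space_prob_algebra space_subprob_algebra prob_space_imp_subprob_space)
    then have "(AE s' in measure_pmf (softmax_policy Qs s) \<bind> (\<lambda>a. P s a). G s') \<longleftrightarrow>
        (AE a in measure_pmf (softmax_policy Qs s). AE s' in P s a. G s')"
      by (rule AE_bind) simp
    then show "(AE s' in measure_pmf (softmax_policy Qs s) \<bind> (\<lambda>a. P s a). G s') \<longleftrightarrow>
        (\<forall>a. AE s' in P s a. G s')"
      by (simp add: AE_measure_pmf_iff set_softmax_policy)
  qed
  finally show ?thesis .
qed

section \<open>The occupancy measure as a mixture over time\<close>

lemma alaw_measurable: "alaw \<in> measure_pmf p \<rightarrow>\<^sub>M subprob_algebra MA"
  using state_action_law_in_prob_algebra[OF mdp Qs_bounded]
  by (auto simp: space_prob_algebra space_subprob_algebra prob_space_imp_subprob_space)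

lemma sets_occ: "sets occ = sets MA"
proof -
  have "sigma_algebra (space M \<times> UNIV) (sets MA)"
    using sets.sigma_algebra_axioms[of MA] by (simp add: space_pair_measure)
  then show ?thesis
    unfolding occupancy_def by (rule sigma_algebra.sets_measure_of_eq)
qed

text \<open>The discount weights are the masses of a geometric distribution, so the occupancy is the
  state-action law at an independent geometric time. In this form the rules for \<open>bind\<close>
  give its integrals and null sets.\<close>

lemma occ_eq_bind: "occ = measure_pmf (geometric_pmf (1 - \<beta>)) \<bind> alaw"
proof (rule measure_eqI)
  have s: "sets (measure_pmf (geometric_pmf (1 - \<beta>)) \<bind> alaw) = sets MA"
    by (rule sets_bind) (use state_action_law_in_prob_algebra[OF mdp Qs_bounded] in
        \<open>auto simp: space_prob_algebra\<close>)
  show "sets occ = sets (measure_pmf (geometric_pmf (1 - \<beta>)) \<bind> alaw)"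
    by (simp only: s sets_occ)
  fix X assume "X \<in> sets occ"
  then have X: "X \<in> sets MA" by (simp add: sets_occ)
  have "emeasure (measure_pmf (geometric_pmf (1 - \<beta>)) \<bind> alaw) X =
      (\<integral>\<^sup>+t. emeasure (alaw t) X \<partial>measure_pmf (geometric_pmf (1 - \<beta>)))"
    by (rule emeasure_bind[OF _ alaw_measurable X]) simp
  also have "\<dots> = (\<integral>\<^sup>+t. ennreal ((1 - \<beta>) * \<beta> ^ t) * emeasure (alaw t) X \<partial>count_space UNIV)"
    using beta by (simp add: nn_integral_measure_pmf mult.commute)
  also have "\<dots> = emeasure occ X"
    by (simp add: nn_integral_count_space_nat emeasure_occupancy[OF mdp Qs_bounded X])
  finally show "emeasure occ X = emeasure (measure_pmf (geometric_pmf (1 - \<beta>)) \<bind> alaw) X" ..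
qed

lemma space_occ: "space occ = space M \<times> UNIV"
  using sets_eq_imp_space_eq[OF sets_occ] by (simp add: space_pair_measure)

lemma nn_integral_occ:
  assumes f: "f \<in> borel_measurable MA"
  shows "(\<integral>\<^sup>+x. f x \<partial>occ) = (\<integral>\<^sup>+t. \<integral>\<^sup>+s. (\<Sum>a\<in>UNIV. f (s, a) * ennreal (choice_prob Qs s a)) \<partial>law t
      \<partial>measure_pmf (geometric_pmf (1 - \<beta>)))"
  unfolding occ_eq_bind
proof (subst nn_integral_bind[OF f alaw_measurable], rule nn_integral_cong)
  fix t
  have "(\<integral>\<^sup>+x. f x \<partial>alaw t) =
      (\<integral>\<^sup>+s. \<integral>\<^sup>+x. f x \<partial>distr (measure_pmf (softmax_policy Qs s)) MA (\<lambda>a. (s, a)) \<partial>law t)"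
    unfolding state_action_law_def
    by (rule nn_integral_bind[OF f])
       (use pair_kernel_measurable in \<open>simp add: measurable_cong_sets[OF sets_law refl]\<close>)
  also have "\<dots> = (\<integral>\<^sup>+s. (\<Sum>a\<in>UNIV. f (s, a) * ennreal (choice_prob Qs s a)) \<partial>law t)"
  proof (rule nn_integral_cong)
    fix s assume "s \<in> space (law t)"
    then have "(\<lambda>a. (s, a)) \<in> measure_pmf (softmax_policy Qs s) \<rightarrow>\<^sub>M MA"
      by (auto simp: space_law space_pair_measure)
    then show "(\<integral>\<^sup>+x. f x \<partial>distr (measure_pmf (softmax_policy Qs s)) MA (\<lambda>a. (s, a))) =
        (\<Sum>a\<in>UNIV. f (s, a) * ennreal (choice_prob Qs s a))"
      using f by (subst nn_integral_distr)
        (auto simp: nn_integral_measure_pmf nn_integral_count_space_finite pmf_softmax_policy mult.commute)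
  qed
  finally show "(\<integral>\<^sup>+x. f x \<partial>alaw t) =
      (\<integral>\<^sup>+s. (\<Sum>a\<in>UNIV. f (s, a) * ennreal (choice_prob Qs s a)) \<partial>law t)" .
qed

text \<open>Every time has positive weight and every action positive probability, so nothing that
  fails at some time, for some action, on a set of positive probability is null for the
  occupancy.\<close>

lemma AE_occ_imp_AE_law:
  assumes F: "Measurable.pred MA (\<lambda>(s, a). F s a)" and AE: "AE (s, a) in occ. F s a"
  shows "AE s in law t. \<forall>a. F s a"
proof -
  have "AE t in measure_pmf (geometric_pmf (1 - \<beta>)). AE (s, a) in alaw t. F s a"
    using AE unfolding occ_eq_bind by (simp add: AE_bind[OF alaw_measurable F])
  then have "AE (s, a) in alaw t. F s a"
    \<comment> \<open>Positivity of \<beta> puts every time \<open>t\<close> in the support of the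
      geometric distribution.\<close>
    using beta by (auto simp: AE_measure_pmf_iff set_pmf_eq)
  then have "AE s in law t. AE (s, a) in distr (measure_pmf (softmax_policy Qs s)) MA (\<lambda>a. (s, a)). F s a"
    unfolding state_action_law_def
    by (subst (asm) AE_bind[OF _ F])
       (use pair_kernel_measurable in \<open>simp_all add: measurable_cong_sets[OF sets_law refl]\<close>)
  then show ?thesis
  proof (rule AE_mp, intro AE_I2 impI)
    fix s assume s: "s \<in> space (law t)"
      and *: "AE (s, a) in distr (measure_pmf (softmax_policy Qs s)) MA (\<lambda>a. (s, a)). F s a"
    have "(\<lambda>a. (s, a)) \<in> measure_pmf (softmax_policy Qs s) \<rightarrow>\<^sub>M MA"
      using s by (auto simp: space_law space_pair_measure)
    from AE_distrD[OF this *] show "\<forall>a. F s a"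
      by (simp add: AE_measure_pmf_iff set_softmax_policy)
  qed
qed

lemma prob_space_occ: "prob_space occ"
proof
  have "emeasure occ (space occ) = (\<integral>\<^sup>+x. 1 \<partial>occ)" by simp
  also have "\<dots> = 1"
    using prob_space.emeasure_space_1[OF prob_space_law]
    by (subst nn_integral_occ)
       (auto simp: sum_ennreal choice_prob_nonneg sum_choice_prob measure_pmf.emeasure_space_1)
  finally show "emeasure occ (space occ) = 1" .
qed

lemma choice_prob_measurable:
  assumes "Q \<in> bounded_Q M"
  shows "(\<lambda>(s, a). choice_prob Q s a) \<in> borel_measurable MA"
proof -
  have [measurable]: "\<And>a. (\<lambda>s. Q s a) \<in> borel_measurable M"
    using assms by (auto simp: bounded_Q_def)
  show ?thesis unfolding choice_prob_def by (rule measurable_pair_finite) measurable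
qed

text \<open>Given the state, the action has weights \<open>choice_prob Qs s a\<close>. They cancel
  the denominators, and the numerators sum to one.\<close>

lemma expectation_choice_ratio:
  assumes Q: "Q \<in> bounded_Q M"
  shows "integrable occ (\<lambda>(s, a). choice_prob Q s a / choice_prob Qs s a)"
    and "(\<integral>(s, a). choice_prob Q s a / choice_prob Qs s a \<partial>occ) = 1"
proof -
  let ?f = "\<lambda>(s, a). choice_prob Q s a / choice_prob Qs s a"
  have m: "?f \<in> borel_measurable MA"
    using choice_prob_measurable[OF Q] choice_prob_measurable[OF Qs_bounded] by (auto simp: split_beta')
  have nn: "0 \<le> ?f x" for x by (auto simp: split_beta choice_prob_nonneg)
  have eq: "ennreal (choice_prob Q s a / choice_prob Qs s a) * ennreal (choice_prob Qs s a) =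
      ennreal (choice_prob Q s a)" for s a
    using choice_prob_pos[of Qs s a]
    by (simp add: choice_prob_nonneg flip: ennreal_mult)
  have "(\<integral>\<^sup>+x. ennreal (?f x) \<partial>occ) = 1"
    using m prob_space.emeasure_space_1[OF prob_space_law]
    by (subst nn_integral_occ)
       (auto simp: eq sum_ennreal choice_prob_nonneg sum_choice_prob measure_pmf.emeasure_space_1)
  moreover have "?f \<in> borel_measurable occ"
    using m by (simp add: measurable_cong_sets[OF sets_occ refl])
  ultimately have "has_bochner_integral occ ?f 1"
    using nn by (intro has_bochner_integral_nn_integral) auto
  then show "integrable occ ?f" "integral\<^sup>L occ ?f = 1"
    by (auto simp: has_bochner_integral_iff)
qed

section \<open>Bellman residuals and integrability of the risk\<close>

lemma soft_bellman_eq: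
  assumes Q: "Q \<in> bounded_Q M" and s: "s \<in> space M"
  shows "soft_bellman P r \<beta> Q s a =
    Qs s a + \<beta> * (\<integral>s'. soft_value Q s' - soft_value Qs s' \<partial>(P s a))"
proof -
  \<comment> \<open>Subtracting this fixed point equation eliminates the reward, so later bounds
    rest on bounds for the two Q-functions alone.\<close>
  have "soft_bellman P r \<beta> Qs s a = Qs s a"
    using opt s by (simp add: soft_optimal_Q_def)
  moreover have "integrable (P s a) (soft_value Q)" "integrable (P s a) (soft_value Qs)"
    using soft_value_integrable[OF _ kernel[OF s]] Q Qs_bounded by auto
  ultimately show ?thesis by (simp add: soft_bellman_def algebra_simps)
qed

lemma soft_bellman_measurable:
  assumes Q: "Q \<in> bounded_Q M"
  shows "(\<lambda>s. soft_bellman P r \<beta> Q s a) \<in> borel_measurable M"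
proof -
  have "(\<lambda>s. P s a) \<in> M \<rightarrow>\<^sub>M subprob_algebra M"
    using mdp by (auto simp: mdp_def intro: measurable_prob_algebraD)
  from measurable_compose[OF this integral_measurable_subprob_algebra[OF soft_value_measurable[OF Q]]]
  have [measurable]: "(\<lambda>s. \<integral>s'. soft_value Q s' \<partial>(P s a)) \<in> borel_measurable M" .
  have [measurable]: "(\<lambda>s. r s a) \<in> borel_measurable M"
    using mdp by (simp add: mdp_def)
  show ?thesis unfolding soft_bellman_def by measurable
qed

lemma bellman_residual_bounded:
  assumes Q: "Q \<in> bounded_Q M"
  obtains B where "\<And>s a. s \<in> space M \<Longrightarrow> \<bar>soft_bellman P r \<beta> Q s a - Q s a\<bar> \<le> B"
proof -
  obtain B1 where B1: "\<And>s a. s \<in> space M \<Longrightarrow> \<bar>Q s a\<bar> \<le> B1"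
    using Q by (auto simp: bounded_Q_def)
  obtain B2 where B2: "\<And>s a. s \<in> space M \<Longrightarrow> \<bar>Qs s a\<bar> \<le> B2"
    using Qs_bounded by (auto simp: bounded_Q_def)
  \<comment> \<open>\<open>B2\<close> bounds \<open>Qs\<close>, the last \<open>B1\<close> bounds
    \<open>Q\<close>, and the middle term bounds the discounted difference of soft values, which are
    1-Lipschitz in the supremum norm.\<close>
  have "\<bar>soft_bellman P r \<beta> Q s a - Q s a\<bar> \<le> (B2 + \<beta> * (B1 + B2)) + B1"
    if s: "s \<in> space M" for s a
  proof -
    interpret prob_space "P s a" using kernel[OF s] by (simp add: space_prob_algebra)
    have i: "integrable (P s a) (\<lambda>s'. soft_value Q s' - soft_value Qs s')"
      using soft_value_integrable[OF _ kernel[OF s]] Q Qs_bounded by auto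
    have "\<bar>\<integral>s'. soft_value Q s' - soft_value Qs s' \<partial>(P s a)\<bar> \<le>
        (\<integral>s'. \<bar>soft_value Q s' - soft_value Qs s'\<bar> \<partial>(P s a))"
      by (rule integral_abs_bound)
    also have "\<dots> \<le> B1 + B2"
    proof (rule integral_le_const)
      show "AE s' in P s a. \<bar>soft_value Q s' - soft_value Qs s'\<bar> \<le> B1 + B2"
        using B1 B2 by (intro AE_I2 soft_value_diff_abs_le)
          (auto simp: space_kernel[OF s] intro!: order.trans[OF abs_triangle_ineq4] add_mono)
    qed (use i in auto)
    finally have "\<bar>\<beta> * (\<integral>s'. soft_value Q s' - soft_value Qs s' \<partial>(P s a))\<bar> \<le> \<beta> * (B1 + B2)"
      using beta by (simp add: abs_mult)
    then show ?thesis
      using B1[OF s, of a] B2[OF s, of a] unfolding soft_bellman_eq[OF Q s] by linarith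
  qed
  then show ?thesis by (rule that)
qed

lemma minus_ln_choice_prob_integrable:
  assumes Q: "Q \<in> bounded_Q M"
  shows "integrable occ (\<lambda>(s, a). - ln (choice_prob Q s a))"
proof -
  interpret prob_space occ by (rule prob_space_occ)
  obtain B1 where B1: "\<And>s a. s \<in> space M \<Longrightarrow> \<bar>Q s a\<bar> \<le> B1"
    using Q by (auto simp: bounded_Q_def)
  obtain B2 where B2: "\<And>s. s \<in> space M \<Longrightarrow> \<bar>soft_value Q s\<bar> \<le> B2"
    using soft_value_bounded[OF Q] by blast
  show ?thesis
  proof (rule integrable_const_bound[of _ "B1 + B2"])
    have "\<bar>Q s a - soft_value Q s\<bar> \<le> B1 + B2" if "s \<in> space M" for s a
      using B1[OF that, of a] B2[OF that] by linarith
    then show "AE x in occ. norm (case x of (s, a) \<Rightarrow> - ln (choice_prob Q s a)) \<le> B1 + B2"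
      by (intro AE_I2) (auto simp: space_occ ln_choice_prob abs_minus_commute)
    show "(\<lambda>(s, a). - ln (choice_prob Q s a)) \<in> borel_measurable occ"
      using choice_prob_measurable[OF Q]
      by (auto simp: measurable_cong_sets[OF sets_occ refl] split_beta')
  qed
qed

lemma anchor_residual_measurable:
  assumes anch: "anch \<in> M \<rightarrow>\<^sub>M count_space UNIV" and Q: "Q \<in> bounded_Q M"
  shows "(\<lambda>(s, a). of_bool (a = anch s) * (soft_bellman P r \<beta> Q s a - Q s a)\<^sup>2) \<in> borel_measurable MA"
proof (rule measurable_pair_finite)
  fix a
  note [measurable] = soft_bellman_measurable[OF Q] anch
  have [measurable]: "(\<lambda>s. Q s a) \<in> borel_measurable M" using Q by (simp add: bounded_Q_def)
  have "(\<lambda>s. of_bool (a = anch s)) \<in> borel_measurable M"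
    unfolding of_bool_def by measurable
  then show "(\<lambda>s. of_bool (a = anch s) * (soft_bellman P r \<beta> Q s a - Q s a)\<^sup>2) \<in> borel_measurable M"
    by measurable
qed

lemma anchor_residual_integrable:
  assumes anch: "anch \<in> M \<rightarrow>\<^sub>M count_space UNIV" and Q: "Q \<in> bounded_Q M"
  shows "integrable occ (\<lambda>(s, a). of_bool (a = anch s) * (soft_bellman P r \<beta> Q s a - Q s a)\<^sup>2)"
proof -
  interpret prob_space occ by (rule prob_space_occ)
  obtain B where B: "\<And>s a. s \<in> space M \<Longrightarrow> \<bar>soft_bellman P r \<beta> Q s a - Q s a\<bar> \<le> B"
    using bellman_residual_bounded[OF Q] by blast
  show ?thesis
  proof (rule integrable_const_bound[of _ "B\<^sup>2"])
    show "AE x in occ. norm (case x of (s, a) \<Rightarrow>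
        of_bool (a = anch s) * (soft_bellman P r \<beta> Q s a - Q s a)\<^sup>2) \<le> B\<^sup>2"
      using power_mono[OF B abs_ge_zero, where n = 2]
      by (intro AE_I2) (auto simp: space_occ)
  qed (use anchor_residual_measurable[OF anch Q] in \<open>simp add: measurable_cong_sets[OF sets_occ refl]\<close>)
qed

section \<open>Excess risk over \<open>Qs\<close> and what it says about minimizers\<close>

definition risk_gap :: "('s \<Rightarrow> 'a) \<Rightarrow> ('s \<Rightarrow> 'a \<Rightarrow> real) \<Rightarrow> 's \<times> 'a \<Rightarrow> real" where
  "risk_gap anch Q = (\<lambda>(s, a).
     (choice_prob Q s a / choice_prob Qs s a - 1 - ln (choice_prob Q s a / choice_prob Qs s a)) +
     of_bool (a = anch s) * (soft_bellman P r \<beta> Q s a - Q s a)\<^sup>2)"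

text \<open>The log-ratio alone has no sign. The added ratio minus one has mean zero under
  \<open>occ\<close> and makes the integrand nonnegative at each point, so a zero mean will force it
  to vanish almost surely.\<close>

lemma risk_gap_nonneg: "0 \<le> risk_gap anch Q x"
  unfolding risk_gap_def
  by (cases x) (simp only: prod.case,
      intro add_nonneg_nonneg ratio_minus_ln_nonneg, simp_all add: choice_prob_pos)

text \<open>The ratio minus one integrates to zero, and the anchor term of \<open>Qs\<close>
  vanishes by its fixed point equation. Integrability of each piece is what permits splitting the
  Bochner integral.\<close>

lemma exp_risk_gap:
  assumes anch: "anch \<in> M \<rightarrow>\<^sub>M count_space UNIV" and Q: "Q \<in> bounded_Q M"
  shows "integrable occ (risk_gap anch Q)"
    and "exp_risk P r \<beta> anch occ Q = exp_risk P r \<beta> anch occ Qs + (\<integral>x. risk_gap anch Q x \<partial>occ)"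
proof -
  interpret prob_space occ by (rule prob_space_occ)
  let ?L = "\<lambda>Q (s, a). - ln (choice_prob Q s a)"
  let ?A = "\<lambda>(s, a). of_bool (a = anch s) * (soft_bellman P r \<beta> Q s a - Q s a)\<^sup>2"
  let ?R = "\<lambda>(s, a). choice_prob Q s a / choice_prob Qs s a"
  have gap: "risk_gap anch Q = (\<lambda>x. ?R x - 1 + ?L Q x - ?L Qs x + ?A x)"
    by (auto simp: risk_gap_def fun_eq_iff ln_divide_pos choice_prob_pos)
  note i = minus_ln_choice_prob_integrable[OF Q] minus_ln_choice_prob_integrable[OF Qs_bounded]
    anchor_residual_integrable[OF anch Q] expectation_choice_ratio(1)[OF Q]
  show "integrable occ (risk_gap anch Q)"
    unfolding gap using i by (intro Bochner_Integration.integrable_add Bochner_Integration.integrable_diff) auto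
  have "(\<integral>x. risk_gap anch Q x \<partial>occ) =
      (\<integral>x. ?R x \<partial>occ) - 1 + (\<integral>x. ?L Q x \<partial>occ) - (\<integral>x. ?L Qs x \<partial>occ) + (\<integral>x. ?A x \<partial>occ)"
    unfolding gap using i by (simp add: prob_space)
  also have "\<dots> = (\<integral>x. ?L Q x \<partial>occ) - (\<integral>x. ?L Qs x \<partial>occ) + (\<integral>x. ?A x \<partial>occ)"
    using expectation_choice_ratio(2)[OF Q] by simp
  finally have g: "(\<integral>x. risk_gap anch Q x \<partial>occ) = \<dots>" .
  have "exp_risk P r \<beta> anch occ Q = (\<integral>x. ?L Q x + ?A x \<partial>occ)"
    unfolding exp_risk_def by (simp add: split_beta')
  also have "\<dots> = (\<integral>x. ?L Q x \<partial>occ) + (\<integral>x. ?A x \<partial>occ)"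
    using i by simp
  finally have e: "exp_risk P r \<beta> anch occ Q = \<dots>" .
  have "exp_risk P r \<beta> anch occ Qs = (\<integral>x. ?L Qs x \<partial>occ)"
    unfolding exp_risk_def
    by (rule Bochner_Integration.integral_cong)
       (use opt in \<open>auto simp: space_occ soft_optimal_Q_def\<close>)
  with e g show "exp_risk P r \<beta> anch occ Q = exp_risk P r \<beta> anch occ Qs + (\<integral>x. risk_gap anch Q x \<partial>occ)"
    by simp
qed

text \<open>Needed for the identification of the reward, where it is applied to a competing reward
  and its own optimal Q-function.\<close>

lemma Qs_is_arg_min:
  assumes "anch \<in> M \<rightarrow>\<^sub>M count_space UNIV"
  shows "is_arg_min (exp_risk P r \<beta> anch occ) (\<lambda>Q. Q \<in> bounded_Q M) Qs"
proof -
  have "exp_risk P r \<beta> anch occ Qs \<le> exp_risk P r \<beta> anch occ Q" if "Q \<in> bounded_Q M" for Q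
    unfolding exp_risk_gap(2)[OF assms that]
    by (simp add: Bochner_Integration.integral_nonneg risk_gap_nonneg)
  then show ?thesis
    using Qs_bounded by (auto simp: is_arg_min_linorder)
qed

text \<open>A minimizer has excess risk zero, so both nonnegative terms of \<open>risk_gap\<close>
  vanish almost surely; \<open>ln x = x - 1\<close> holds only at \<open>x = 1\<close>.\<close>

lemma arg_min_AE:
  assumes anch: "anch \<in> M \<rightarrow>\<^sub>M count_space UNIV"
    and min: "is_arg_min (exp_risk P r \<beta> anch occ) (\<lambda>Q. Q \<in> bounded_Q M) Q"
  shows "AE s in law t. (\<forall>a. choice_prob Q s a = choice_prob Qs s a) \<and>
    soft_bellman P r \<beta> Q s (anch s) = Q s (anch s)"
proof -
  have Q: "Q \<in> bounded_Q M" using min by (simp add: is_arg_min_def)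
  have "exp_risk P r \<beta> anch occ Q \<le> exp_risk P r \<beta> anch occ Qs"
    using min Qs_bounded by (simp add: is_arg_min_linorder)
  then have "(\<integral>x. risk_gap anch Q x \<partial>occ) \<le> 0"
    using exp_risk_gap(2)[OF anch Q] by simp
  then have "(\<integral>x. risk_gap anch Q x \<partial>occ) = 0"
    by (intro antisym Bochner_Integration.integral_nonneg risk_gap_nonneg)
  then have "AE x in occ. risk_gap anch Q x = 0"
    using integral_nonneg_eq_0_iff_AE[OF exp_risk_gap(1)[OF anch Q]] risk_gap_nonneg by auto
  then have AE: "AE (s, a) in occ. risk_gap anch Q (s, a) = 0"
    by (simp add: split_beta')
  have "risk_gap anch Q \<in> borel_measurable MA"
    using borel_measurable_integrable[OF exp_risk_gap(1)[OF anch Q]]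
    by (simp only: measurable_cong_sets[OF sets_occ refl])
  then have "Measurable.pred MA (\<lambda>(s, a). risk_gap anch Q (s, a) = 0)"
    by (simp add: split_beta')
  from AE_occ_imp_AE_law[OF this AE] have "AE s in law t. \<forall>a. risk_gap anch Q (s, a) = 0" .
  then show ?thesis
  proof (rule AE_mp, intro AE_I2 impI conjI allI)
    fix s assume z: "\<forall>a. risk_gap anch Q (s, a) = 0"
    have x: "choice_prob Q s a / choice_prob Qs s a - 1 - ln (choice_prob Q s a / choice_prob Qs s a) = 0"
      and y: "of_bool (a = anch s) * (soft_bellman P r \<beta> Q s a - Q s a)\<^sup>2 = 0" for a
    proof -
      have "0 \<le> choice_prob Q s a / choice_prob Qs s a - 1 - ln (choice_prob Q s a / choice_prob Qs s a)"
        by (intro ratio_minus_ln_nonneg) (simp add: choice_prob_pos)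
      moreover have "0 \<le> of_bool (a = anch s) * (soft_bellman P r \<beta> Q s a - Q s a)\<^sup>2" by simp
      ultimately show
        "choice_prob Q s a / choice_prob Qs s a - 1 - ln (choice_prob Q s a / choice_prob Qs s a) = 0"
        "of_bool (a = anch s) * (soft_bellman P r \<beta> Q s a - Q s a)\<^sup>2 = 0"
        using z[rule_format, of a] unfolding risk_gap_def prod.case by linarith+
    qed
    show "choice_prob Q s a = choice_prob Qs s a" for a
    proof -
      have "choice_prob Q s a / choice_prob Qs s a = 1"
        using x[of a] by (intro ln_eq_minus_one) (simp_all add: choice_prob_pos)
      then show ?thesis using choice_prob_pos[of Qs s a] by simp
    qed
    \<comment> \<open>The residual is seen only at the anchor, and \<open>y\<close> may be used
      there because it holds for every action, not just the sampled one.\<close>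
    show "soft_bellman P r \<beta> Q s (anch s) = Q s (anch s)"
      using y[of "anch s"] by simp
  qed
qed

text \<open>The contraction argument for uniqueness of the fixed point, with the supremum over all
  states replaced by almost sure bounds under the state laws. One Bellman equation per state
  suffices, since the gap \<open>Q s a - Qs s a\<close> is the same for all actions.\<close>

lemma arg_min_soft_value_AE:
  assumes anch: "anch \<in> M \<rightarrow>\<^sub>M count_space UNIV"
    and min: "is_arg_min (exp_risk P r \<beta> anch occ) (\<lambda>Q. Q \<in> bounded_Q M) Q"
  shows "AE s in law t. soft_value Q s = soft_value Qs s"
proof -
  have Q: "Q \<in> bounded_Q M" using min by (simp add: is_arg_min_def)
  obtain B B' where B: "\<And>s. s \<in> space M \<Longrightarrow> \<bar>soft_value Q s\<bar> \<le> B"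
    and B': "\<And>s. s \<in> space M \<Longrightarrow> \<bar>soft_value Qs s\<bar> \<le> B'"
    using soft_value_bounded[OF Q] soft_value_bounded[OF Qs_bounded] by metis
  note [measurable] = soft_value_measurable[OF Q] soft_value_measurable[OF Qs_bounded]
  have bound: "AE s in law t. \<bar>soft_value Q s - soft_value Qs s\<bar> \<le> \<beta> ^ n * (B + B')" for n t
  \<comment> \<open>The bound at time \<open>t\<close> with exponent \<open>Suc n\<close> comes from
    the bound at time \<open>Suc t\<close> with exponent \<open>n\<close>, so \<open>t\<close> must
    vary.\<close>
  proof (induction n arbitrary: t)
    case 0
    show ?case
      using B B' by (intro AE_I2)
        (fastforce simp: space_law intro: order.trans[OF abs_triangle_ineq4] add_mono)
  next
    case (Suc n)
    have "AE s in law t. \<forall>a. AE s' in P s a. \<bar>soft_value Q s' - soft_value Qs s'\<bar> \<le> \<beta> ^ n * (B + B')"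
      using Suc.IH[of "Suc t"] by (subst (asm) AE_law_Suc) auto
    with arg_min_AE[OF anch min, of t] AE_space show ?case
    proof eventually_elim
      case (elim s)
      then have s: "s \<in> space M" by (simp add: space_law)
      let ?a = "anch s"
      interpret prob_space "P s ?a" using kernel[OF s] by (simp add: space_prob_algebra)
      have i: "integrable (P s ?a) (\<lambda>s'. soft_value Q s' - soft_value Qs s')"
        using soft_value_integrable[OF _ kernel[OF s]] Q Qs_bounded by auto
      \<comment> \<open>Equal choice probabilities move the soft value gap to the Q gap at the
        anchor, where the vanishing residual turns it into a discounted mean over
        successors.\<close>
      have "ln (choice_prob Q s ?a) = ln (choice_prob Qs s ?a)" using elim by simp
      then have "soft_value Q s - soft_value Qs s = Q s ?a - Qs s ?a"
        by (simp add: ln_choice_prob)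
      also have "\<dots> = \<beta> * (\<integral>s'. soft_value Q s' - soft_value Qs s' \<partial>(P s ?a))"
        using elim soft_bellman_eq[OF Q s, of ?a] by simp
      finally have "\<bar>soft_value Q s - soft_value Qs s\<bar> =
          \<beta> * \<bar>\<integral>s'. soft_value Q s' - soft_value Qs s' \<partial>(P s ?a)\<bar>"
        using beta by (simp add: abs_mult)
      also have "\<dots> \<le> \<beta> * (\<integral>s'. \<bar>soft_value Q s' - soft_value Qs s'\<bar> \<partial>(P s ?a))"
        using beta by (intro mult_left_mono integral_abs_bound) auto
      also have "\<dots> \<le> \<beta> * (\<beta> ^ n * (B + B'))"
        using beta elim i by (intro mult_left_mono integral_le_const) auto
      finally show ?case by (simp add: mult.assoc)
    qed
  qed
  \<comment> \<open>Countably many null sets are discarded at once, so that the limit in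
    \<open>n\<close> can be taken at a fixed state.\<close>
  have "AE s in law t. \<forall>n. \<bar>soft_value Q s - soft_value Qs s\<bar> \<le> \<beta> ^ n * (B + B')"
    using bound by (simp add: AE_all_countable)
  then show ?thesis
  proof eventually_elim
    case (elim s)
    have "(\<lambda>n. \<beta> ^ n * (B + B')) \<longlonglongrightarrow> 0 * (B + B')"
      using beta by (intro tendsto_mult_right LIMSEQ_realpow_zero) auto
    then have "\<bar>soft_value Q s - soft_value Qs s\<bar> \<le> 0 * (B + B')"
      using elim by (intro LIMSEQ_le_const) auto
    then show ?case by simp
  qed
qed

lemma arg_min_on_reachable:
  assumes anch: "anch \<in> M \<rightarrow>\<^sub>M count_space UNIV"
    and min: "is_arg_min (exp_risk P r \<beta> anch occ) (\<lambda>Q. Q \<in> bounded_Q M) Q"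
    and s: "s \<in> reachable_states M P \<nu> (softmax_policy Qs)"
  shows "Q s a = Qs s a"
    and "r s a = Q s a - \<beta> * (\<integral>s'. soft_value Q s' \<partial>(P s a))"
proof -
  have Q: "Q \<in> bounded_Q M" using min by (simp add: is_arg_min_def)
  note [measurable] = soft_value_measurable[OF Q] soft_value_measurable[OF Qs_bounded]
  from s obtain h where sM: "s \<in> space M" and h: "measure (law h) {s} > 0"
    by (auto simp: reachable_states_def)
  have "choice_prob Q s a = choice_prob Qs s a"
    using AE_at_atom[OF arg_min_AE[OF anch min] h] by blast
  then have "Q s a - soft_value Q s = Qs s a - soft_value Qs s"
    by (simp flip: ln_choice_prob)
  then show eq: "Q s a = Qs s a"
    using AE_at_atom[OF arg_min_soft_value_AE[OF anch min] h] by simp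
  \<comment> \<open>\<open>P s a\<close> may have no atoms, so agreement at reachable states need
    not control its integral. The almost sure agreement at time \<open>Suc h\<close> does.\<close>
  have "AE s in law h. \<forall>a. AE s' in P s a. soft_value Q s' = soft_value Qs s'"
    using arg_min_soft_value_AE[OF anch min, of "Suc h"] by (subst (asm) AE_law_Suc) auto
  from AE_at_atom[OF this h] have "AE s' in P s a. soft_value Q s' = soft_value Qs s'" by simp
  moreover have "sets (P s a) = sets M"
    using kernel[OF sM] by (simp add: space_prob_algebra)
  ultimately have "(\<integral>s'. soft_value Q s' \<partial>(P s a)) = (\<integral>s'. soft_value Qs s' \<partial>(P s a))"
    by (intro integral_cong_AE) (simp_all cong: measurable_cong_sets)
  moreover have "soft_bellman P r \<beta> Qs s a = Qs s a"
    using opt sM by (simp add: soft_optimal_Q_def)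
  ultimately show "r s a = Q s a - \<beta> * (\<integral>s'. soft_value Q s' \<partial>(P s a))"
    using eq by (simp add: soft_bellman_def)
qed

end

text \<open>The last conjunct makes unique identification precise: the available data are the
  occupancy and the anchor rewards, and rewards compatible with the same data cannot differ on
  \<open>Sbar\<close>.\<close>

theorem theorem3:
  fixes M :: "'s measure"
    and P :: "'s \<Rightarrow> 'a::finite \<Rightarrow> 's measure"
    and \<nu> :: "'s measure"
    and r Qstar Qhat :: "'s \<Rightarrow> 'a \<Rightarrow> real"
    and \<beta> :: real
    and anch :: "'s \<Rightarrow> 'a"
  defines "dstar \<equiv> occupancy M P \<nu> \<beta> (softmax_policy Qstar)"
    and "Sbar \<equiv> reachable_states M P \<nu> (softmax_policy Qstar)"
  assumes mdp: "mdp M P \<nu> r \<beta>"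
    and anch: "anch \<in> M \<rightarrow>\<^sub>M count_space UNIV"
    and Qstar: "soft_optimal_Q M P r \<beta> Qstar"
    and Qhat: "is_arg_min (exp_risk P r \<beta> anch dstar) (\<lambda>Q. Q \<in> bounded_Q M) Qhat"
  shows "(\<forall>s\<in>Sbar. \<forall>a. Qhat s a = Qstar s a) \<and>
         (\<forall>s\<in>Sbar. \<forall>a. r s a = Qhat s a - \<beta> * (\<integral>s'. soft_value Qhat s' \<partial>(P s a))) \<and>
         (\<forall>r' Qstar'.
            mdp M P \<nu> r' \<beta> \<longrightarrow>
            soft_optimal_Q M P r' \<beta> Qstar' \<longrightarrow>
            (\<forall>s\<in>space M. r' s (anch s) = r s (anch s)) \<longrightarrow>
            occupancy M P \<nu> \<beta> (softmax_policy Qstar') = dstar \<longrightarrow>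
            (\<forall>s\<in>Sbar. \<forall>a. r' s a = r s a))"
proof -
  interpret soft_optimal_mdp M P \<nu> r \<beta> Qstar
    using mdp Qstar by unfold_locales
  have "r' s a = r s a"
    if mdp': "mdp M P \<nu> r' \<beta>" and Qstar': "soft_optimal_Q M P r' \<beta> Qstar'"
      and anchors: "\<forall>s\<in>space M. r' s (anch s) = r s (anch s)"
      and occ': "occupancy M P \<nu> \<beta> (softmax_policy Qstar') = dstar"
      and s: "s \<in> Sbar" for r' Qstar' s a
  proof -
    \<comment> \<open>A second instance of the same theory, now for the competing reward.\<close>
    interpret alt: soft_optimal_mdp M P \<nu> r' \<beta> Qstar'
      using mdp' Qstar' by unfold_locales
    have "exp_risk P r' \<beta> anch dstar Q = exp_risk P r \<beta> anch dstar Q" for Q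
      unfolding exp_risk_def dstar_def
      by (rule Bochner_Integration.integral_cong)
         (use anchors in \<open>auto simp: space_occ soft_bellman_def\<close>)
    \<comment> \<open>By \<open>occ'\<close>, the minimization problem solved by
      \<open>Qstar'\<close> is the original one, so \<open>Qstar'\<close> can take the role of
      \<open>Qhat\<close>.\<close>
    then have "is_arg_min (exp_risk P r \<beta> anch dstar) (\<lambda>Q. Q \<in> bounded_Q M) Qstar'"
      using alt.Qs_is_arg_min[OF anch] unfolding occ' by (simp add: is_arg_min_def)
    then have "r s a = Qstar' s a - \<beta> * (\<integral>s'. soft_value Qstar' s' \<partial>(P s a))"
      using arg_min_on_reachable(2)[OF anch] s unfolding dstar_def Sbar_def by blast
    \<comment> \<open>The fixed point equation of \<open>Qstar'\<close> for \<open>r'\<close>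
      expresses \<open>r'\<close> by the formula just obtained for \<open>r\<close>.\<close>
    moreover have "s \<in> space M" using s by (simp add: Sbar_def reachable_states_def)
    then have "soft_bellman P r' \<beta> Qstar' s a = Qstar' s a"
      using Qstar' by (simp add: soft_optimal_Q_def)
    ultimately show ?thesis by (simp add: soft_bellman_def)
  qed
  then show ?thesis
    using arg_min_on_reachable[OF anch Qhat[unfolded dstar_def]] unfolding Sbar_def by blast
qed

end
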